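(* For each $\alpha \in [0,1]$, the $\alpha$-level set $L_\alpha^* = \{ x \in [0,1] : \lambda^*(x) = \alpha \}$ of the convergence exponent $\lambda^*$ has cardinality $\mathfrak{c}$, i.e., the cardinality of $\mathbb{R}$.
   Context: Pierce digits. For $x \in [0,1]$, define $d_1(x) := \lfloor 1/x \rfloor$ and $T(x) := 1 - d_1(x)\,x$ if $x \neq 0$, and $d_1(0) := \infty$, $T(0) := 0$. Here $\lfloor y \rfloor$ is the largest integer not exceeding $y$. For $n \in \mathbb{N} = \{1,2,3,\dots\}$ put $d_n(x) := d_1(T^{n-1}(x))$, where $T^{n-1}$ is the $(n-1)$-fold iterate of $T$ ($T^0$ is the identity). The sequence $(d_n(x))_{n \in \mathbb{N}}$ is the Pierce expansion digit sequence of $x$. Conventions: $\infty^s := \infty$ for $s>0$ and $c/\infty := 0$ for $c \in \mathbb{R}$. Convergence exponent: for $x \in [0,1]$, $\lambda^*(x) := \inf\{ s > 0 : \sum_{n \in \mathbb{N}} 1/(d_n(x))^s \text{ converges} \}$. The function $\lambda^*$ takes values in $[0,1]$. *)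

theory Defs
  imports Complex_Main "HOL-Library.Equipollence" "HOL-Library.Extended_Real"
begin

text \<open>
  All functions are meant for arguments in the unit interval, which \<open>pierce_T\<close> maps into itself;
  values at other reals are irrelevant.
\<close>

definition pierce_d1 :: "real \<Rightarrow> enat" where
  "pierce_d1 x = (if x = 0 then \<infinity> else enat (nat \<lfloor>1 / x\<rfloor>))"

definition pierce_T :: "real \<Rightarrow> real" where
  "pierce_T x = (if x = 0 then 0 else 1 - real (the_enat (pierce_d1 x)) * x)"

text \<open>Digits are indexed from \<open>n = 1\<close>.\<close>

definition pierce_digit :: "nat \<Rightarrow> real \<Rightarrow> enat" where
  "pierce_digit n x = pierce_d1 ((pierce_T ^^ (n - 1)) x)"

text \<open>
  The quantity \<open>1 / d\<^sup>s\<close> for \<open>s > 0\<close>, with the conventions \<open>\<infinity>\<^sup>s = \<infinity>\<close> and \<open>1 / \<infinity> = 0\<close>.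
\<close>

definition recip_powr :: "enat \<Rightarrow> real \<Rightarrow> real" where
  "recip_powr d s = (case d of enat k \<Rightarrow> 1 / (real k powr s) | \<infinity> \<Rightarrow> 0)"

text \<open>
  The infimum is taken in the extended reals, so that it is the usual infimum without a
  separate argument that the set of admissible exponents is nonempty.
\<close>

definition convergence_exponent :: "real \<Rightarrow> ereal" where
  "convergence_exponent x =
     Inf {ereal s | s. s > 0 \<and> summable (\<lambda>n. recip_powr (pierce_digit (Suc n) x) s)}"

definition level_set :: "real \<Rightarrow> real set" where
  "level_set \<alpha> = {x \<in> {0..1}. convergence_exponent x = ereal \<alpha>}"

end

theory Submission
  imports Defs "HOL-Analysis.Summation_Tests"
begin

text \<open>
  Every strictly increasing sequence of positive integers \<open>a 0 < a 1 < \<dots>\<close> is the Pierce digit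
  sequence of a real number in the unit interval, namely of the alternating series
  \<open>1 / a 0 - 1 / (a 0 * a 1) + 1 / (a 0 * a 1 * a 2) - \<dots>\<close>. The reason is that this series \<open>x\<close>
  satisfies \<open>x = (1 - t) / a 0\<close>, where \<open>t\<close> is the series of the sequence without its first
  term, and that \<open>0 < t < 1 / a 1 \<le> 1 / (a 0 + 1)\<close>. Hence \<open>1 / (a 0 + 1) < x < 1 / a 0\<close>, so the
  first digit of \<open>x\<close> is \<open>a 0\<close> and \<open>T x = t\<close>; iterating yields all digits
  (\<open>pierce_digit_value\<close>).

  The convergence exponent depends only on the growth of the digits. So it suffices to find one
  digit sequence \<open>f\<close> with the exponent \<open>\<alpha>\<close> and to perturb it in continuum many ways by a bounded
  factor: for each set \<open>B\<close> of naturals, \<open>2 * f n + of_bool (n \<in> B)\<close> is strictly increasing,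
  lies between \<open>f n\<close> and \<open>3 * f n\<close>, and determines \<open>B\<close>. Since the reals embed into the sets of
  naturals (as cuts of an enumeration of the rationals), the level set contains a copy of the
  reals (\<open>level_set_eqpoll_real\<close>); the Schroeder-Bernstein theorem then gives equality of
  cardinalities.

  For \<open>\<alpha> = 0\<close> the sequence \<open>2 ^ n\<close> serves as \<open>f\<close>. For \<open>0 < \<alpha> \<le> 1\<close> one takes the integer part of
  \<open>(n + 1) powr (1 / \<alpha>)\<close>: as \<open>1 / \<alpha> \<ge> 1\<close>, consecutive powers differ by at least 1, which makes
  their integer parts strictly increasing.
\<close>

section \<open>Numbers with prescribed Pierce digits\<close>

definition pierce_value :: "(nat \<Rightarrow> nat) \<Rightarrow> real" where
  "pierce_value a = (\<Sum>n. (-1) ^ n * (1 / (\<Prod>i\<le>n. real (a i))))"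

text \<open>The digit sequences of infinite Pierce expansions, indexed from 0.\<close>

definition digit_seq :: "(nat \<Rightarrow> nat) \<Rightarrow> bool" where
  "digit_seq a \<longleftrightarrow> strict_mono a \<and> 0 < a 0"

lemma digit_seq_pos: "digit_seq a \<Longrightarrow> 0 < a n"
  unfolding digit_seq_def by (metis le0 less_le_trans strict_mono_less_eq)

lemma digit_seq_ge: "digit_seq a \<Longrightarrow> Suc n \<le> a n"
proof (induction n)
  case (Suc n)
  then show ?case
    using strict_monoD[of a n "Suc n"] by (auto simp: digit_seq_def)
qed (auto simp: digit_seq_def)

lemma digit_seq_shift: "digit_seq a \<Longrightarrow> digit_seq (\<lambda>n. a (n + k))"
  using digit_seq_pos[of a k] by (auto simp: digit_seq_def strict_mono_def)

text \<open>
  The denominators increase to infinity because \<open>a n \<ge> n + 1\<close>, so Leibniz' criterion applies, and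
  the first two partial sums, \<open>0\<close> and \<open>1 / a 0\<close>, bound the value.
\<close>

lemma
  assumes a: "digit_seq a"
  shows summable_pierce: "summable (\<lambda>n. (-1) ^ n * (1 / (\<Prod>i\<le>n. real (a i))))"
    and pierce_value_nonneg: "0 \<le> pierce_value a"
    and pierce_value_le: "pierce_value a \<le> 1 / real (a 0)"
proof -
  define c where "c n = 1 / (\<Prod>i\<le>n. real (a i))" for n
  have ge: "real (a n) \<ge> real (Suc n)" for n
    using digit_seq_ge[OF a, of n] by (simp only: of_nat_le_iff)
  have ge1: "real (a n) \<ge> 1" for n
    using ge[of n] by simp
  have prod_ge: "(\<Prod>i\<le>n. real (a i)) \<ge> 1" for n
    by (intro prod_ge_1) (use ge1 in auto)
  have c_pos: "c n > 0" for n
    unfolding c_def using prod_ge[of n] by simp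
  have c_Suc: "c (Suc n) = c n / real (a (Suc n))" for n
    unfolding c_def by simp
  have c_le: "c n \<le> 1 / real (Suc n)" for n
  proof (cases n)
    case 0
    then show ?thesis using ge1[of 0] by (simp add: c_def)
  next
    case (Suc m)
    have "c m \<le> 1" using prod_ge[of m] by (simp add: c_def)
    then have "c m / real (a n) \<le> 1 / real (Suc n)"
      using ge[of n] by (intro frac_le) auto
    then show ?thesis using c_Suc[of m] Suc by simp
  qed
  have "c \<longlonglongrightarrow> 0"
    by (rule tendsto_sandwich[OF _ _ tendsto_const LIMSEQ_inverse_real_of_nat])
       (use c_pos c_le in \<open>auto intro!: always_eventually less_imp_le simp: divide_inverse\<close>)
  moreover have dec: "c (Suc n) \<le> c n" for n
    unfolding c_Suc using c_pos[of n] ge1[of "Suc n"] by (simp add: divide_le_eq)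
  ultimately have S: "summable (\<lambda>n. (-1) ^ n * c n)"
    and B: "\<And>n. (\<Sum>i<2*n. (-1)^i * c i) \<le> (\<Sum>i. (-1)^i * c i)"
           "\<And>n. (\<Sum>i. (-1)^i * c i) \<le> (\<Sum>i<2*n+1. (-1)^i * c i)"
    using summable_Leibniz'[of c] c_pos less_imp_le[OF c_pos] by auto
  show "summable (\<lambda>n. (-1) ^ n * (1 / (\<Prod>i\<le>n. real (a i))))"
    using S by (simp add: c_def)
  show "0 \<le> pierce_value a" using B(1)[of 0] by (simp add: pierce_value_def c_def)
  show "pierce_value a \<le> 1 / real (a 0)" using B(2)[of 0] by (simp add: pierce_value_def c_def)
qed

lemma pierce_value_rec:
  assumes a: "digit_seq a"
  shows "pierce_value a = (1 - pierce_value (\<lambda>n. a (Suc n))) / real (a 0)"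
proof -
  let ?b = "\<lambda>n. a (Suc n)"
  have b: "digit_seq ?b" using digit_seq_shift[OF a, of 1] by simp
  have "pierce_value a = 1 / real (a 0)
      + (\<Sum>n. (-1) ^ Suc n * (1 / (\<Prod>i\<le>Suc n. real (a i))))"
    using suminf_split_head[OF summable_pierce[OF a]] by (simp add: pierce_value_def)
  also have "(\<lambda>n. (-1) ^ Suc n * (1 / (\<Prod>i\<le>Suc n. real (a i))))
      = (\<lambda>n. - (1 / real (a 0)) * ((-1) ^ n * (1 / (\<Prod>i\<le>n. real (?b i)))))"
    by (simp only: prod.atMost_Suc_shift) (simp add: fun_eq_iff)
  also have "suminf \<dots> = - (1 / real (a 0)) * pierce_value ?b"
    unfolding pierce_value_def by (rule suminf_mult[OF summable_pierce[OF b]])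
  finally show ?thesis by (simp add: diff_divide_distrib)
qed

text \<open>
  The weak bounds become strict by applying them to the shifted sequence: its first term is at
  least 2, so its value \<open>t\<close> is at most 1/2 and \<open>(1 - t) / a 0\<close> is positive; this positivity, used
  for the shifted sequence in turn, makes \<open>(1 - t) / a 0\<close> smaller than \<open>1 / a 0\<close>.
\<close>

lemma
  assumes a: "digit_seq a"
  shows pierce_value_pos: "0 < pierce_value a"
    and pierce_value_less: "pierce_value a < 1 / real (a 0)"
proof -
  have pos: "0 < pierce_value b" if b: "digit_seq b" for b
  proof -
    let ?c = "\<lambda>n. b (Suc n)"
    have c: "digit_seq ?c" using digit_seq_shift[OF b, of 1] by simp
    have "1 / real (?c 0) \<le> 1 / 2"
      using digit_seq_ge[OF b, of 1] by (intro frac_le) auto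
    then have "pierce_value ?c < 1" using pierce_value_le[OF c] by linarith
    then show ?thesis
      using pierce_value_rec[OF b] digit_seq_pos[OF b, of 0] by simp
  qed
  show "0 < pierce_value a" by (rule pos[OF a])
  have "0 < pierce_value (\<lambda>n. a (Suc n))"
    using digit_seq_shift[OF a, of 1] by (intro pos) simp
  then show "pierce_value a < 1 / real (a 0)"
    using pierce_value_rec[OF a] digit_seq_pos[OF a, of 0] by (simp add: divide_strict_right_mono)
qed

text \<open>
  Strict monotonicity of \<open>a\<close> enters here: it gives \<open>t < 1 / a 1 \<le> 1 / (a 0 + 1)\<close> for the tail
  value \<open>t\<close>, which is exactly what \<open>(1 - t) / a 0 > 1 / (a 0 + 1)\<close> requires.
\<close>

lemma pierce_d1_value:
  assumes a: "digit_seq a"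
  shows "pierce_d1 (pierce_value a) = enat (a 0)"
proof -
  let ?x = "pierce_value a" and ?t = "pierce_value (\<lambda>n. a (Suc n))"
  have b: "digit_seq (\<lambda>n. a (Suc n))" using digit_seq_shift[OF a, of 1] by simp
  have a0: "real (a 0) > 0" using digit_seq_pos[OF a, of 0] by simp
  have "a 0 + 1 \<le> a 1" using a by (simp add: digit_seq_def Suc_le_eq strict_mono_less)
  then have "1 / real (a 1) \<le> 1 / (real (a 0) + 1)"
    using a0 by (intro frac_le) auto
  then have t: "?t < 1 / (real (a 0) + 1)" using pierce_value_less[OF b] by simp
  have x: "?x > 0" by (rule pierce_value_pos[OF a])
  have "?x * (real (a 0) + 1) > 1"
  proof -
    have "1 - ?t > real (a 0) / (real (a 0) + 1)" using t a0 by (simp add: field_simps)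
    then have "?x > 1 / (real (a 0) + 1)"
      using a0 unfolding pierce_value_rec[OF a] by (simp add: field_simps)
    then show ?thesis using a0 by (simp add: field_simps)
  qed
  moreover have "?x * real (a 0) \<le> 1"
    using pierce_value_le[OF a] a0 by (simp add: field_simps)
  ultimately have "\<lfloor>1 / ?x\<rfloor> = int (a 0)"
    using x by (intro floor_unique) (simp_all add: field_simps)
  then show ?thesis using x by (simp add: pierce_d1_def)
qed

lemma pierce_T_value:
  assumes a: "digit_seq a"
  shows "pierce_T (pierce_value a) = pierce_value (\<lambda>n. a (Suc n))"
proof -
  have "real (a 0) * pierce_value a = 1 - pierce_value (\<lambda>n. a (Suc n))"
    using pierce_value_rec[OF a] digit_seq_pos[OF a, of 0] by simp
  then show ?thesis
    using pierce_value_pos[OF a] by (simp add: pierce_T_def pierce_d1_value[OF a])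
qed

lemma pierce_digit_value:
  assumes a: "digit_seq a"
  shows "pierce_digit (Suc n) (pierce_value a) = enat (a n)"
proof -
  have "(pierce_T ^^ n) (pierce_value a) = pierce_value (\<lambda>k. a (k + n))"
  proof (induction n)
    case (Suc n)
    then show ?case using pierce_T_value[OF digit_seq_shift[OF a, of n]] by simp
  qed simp
  then show ?thesis
    using pierce_d1_value[OF digit_seq_shift[OF a, of n]] by (simp add: pierce_digit_def)
qed

section \<open>Level sets and perturbed digit sequences\<close>

lemma convergence_exponent_eqI:
  assumes "\<alpha> \<ge> 0"
    and "\<And>s. s > \<alpha> \<Longrightarrow> summable (\<lambda>n. recip_powr (pierce_digit (Suc n) x) s)"
    and "\<And>s. 0 < s \<Longrightarrow> s < \<alpha> \<Longrightarrow> \<not> summable (\<lambda>n. recip_powr (pierce_digit (Suc n) x) s)"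
  shows "convergence_exponent x = ereal \<alpha>"
proof (rule antisym)
  show "convergence_exponent x \<le> ereal \<alpha>"
  proof (rule ereal_le_epsilon2)
    fix e :: real assume "0 < e"
    then show "convergence_exponent x \<le> ereal \<alpha> + ereal e"
      unfolding convergence_exponent_def
      by (intro Inf_lower) (use assms(1) assms(2)[of "\<alpha> + e"] in auto)
  qed
  show "ereal \<alpha> \<le> convergence_exponent x"
    unfolding convergence_exponent_def
    by (intro Inf_greatest) (use assms(3) in \<open>force simp: not_less[symmetric]\<close>)
qed

text \<open>
  The factor 2 leaves a gap between consecutive values, so that adding 0 or 1 keeps the sequence
  strictly increasing.
\<close>

definition perturb :: "(nat \<Rightarrow> nat) \<Rightarrow> nat set \<Rightarrow> nat \<Rightarrow> nat" where
  "perturb f B n = 2 * f n + of_bool (n \<in> B)"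

lemma digit_seq_perturb:
  assumes "digit_seq f"
  shows "digit_seq (perturb f B)"
  unfolding digit_seq_def
proof
  show "strict_mono (perturb f B)"
    unfolding strict_mono_Suc_iff
  proof
    fix n
    have "f n < f (Suc n)" using assms by (simp add: digit_seq_def strict_mono_less)
    then show "perturb f B n < perturb f B (Suc n)" by (simp add: perturb_def of_bool_def)
  qed
qed (use assms in \<open>simp add: perturb_def digit_seq_def\<close>)

lemma inj_perturb: "inj (perturb f)"
proof (rule injI)
  fix B C assume eq: "perturb f B = perturb f C"
  have "n \<in> B \<longleftrightarrow> n \<in> C" for n
    using fun_cong[OF eq, of n] by (auto simp: perturb_def of_bool_def split: if_splits)
  then show "B = C" by blast
qed

text \<open>
  A real number is determined by the set of rationals below it; the rationals are
  enumerated by \<open>from_nat\<close>.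
\<close>

lemma inj_cut: "inj (\<lambda>x :: real. {n. of_rat (from_nat n) < x})"
proof (rule linorder_injI)
  fix x y :: real assume "x < y"
  then obtain q where "x < of_rat q" "of_rat q < y" using of_rat_dense by blast
  then have "to_nat q \<in> {n. of_rat (from_nat n) < y} - {n. of_rat (from_nat n) < x}" by simp
  then show "{n. of_rat (from_nat n) < x} \<noteq> {n. of_rat (from_nat n) < y}" by blast
qed

text \<open>Both directions are comparison tests, since \<open>f n \<le> perturb f B n \<le> 3 * f n\<close>.\<close>

lemma summable_perturb_iff:
  assumes f: "digit_seq f" and s: "s > 0"
  shows "summable (\<lambda>n. 1 / real (perturb f B n) powr s) \<longleftrightarrow> summable (\<lambda>n. 1 / real (f n) powr s)"
proof
  have f_pos: "real (f n) > 0" for n using digit_seq_pos[OF f] by simp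
  have lower: "real (f n) \<le> real (perturb f B n)" for n by (simp add: perturb_def)
  have "perturb f B n \<le> 3 * f n" for n
    using digit_seq_pos[OF f, of n] by (simp add: perturb_def of_bool_def)
  then have upper: "real (perturb f B n) \<le> 3 * real (f n)" for n
    using of_nat_mono[of "perturb f B n" "3 * f n"] by simp
  have pos: "real (perturb f B n) > 0" for n using f_pos lower less_le_trans by blast
  {
    assume "summable (\<lambda>n. 1 / real (f n) powr s)"
    then show "summable (\<lambda>n. 1 / real (perturb f B n) powr s)"
      by (rule summable_comparison_test'[where N = 0])
         (use f_pos lower s in \<open>auto intro!: frac_le powr_mono2\<close>)
  next
    assume "summable (\<lambda>n. 1 / real (perturb f B n) powr s)"
    then have "summable (\<lambda>n. 3 powr s * (1 / real (perturb f B n) powr s))"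
      by (rule summable_mult)
    then show "summable (\<lambda>n. 1 / real (f n) powr s)"
    proof (rule summable_comparison_test'[where N = 0])
      fix n
      have "real (perturb f B n) powr s \<le> 3 powr s * real (f n) powr s"
        using powr_mono2[OF _ _ upper[of n], of s] s pos f_pos by (simp add: powr_mult)
      then show "norm (1 / real (f n) powr s) \<le> 3 powr s * (1 / real (perturb f B n) powr s)"
        using f_pos[of n] pos[of n] by (simp add: field_simps)
    qed
  }
qed

text \<open>
  One digit sequence with convergence exponent \<open>\<alpha>\<close> yields continuum many numbers in the level
  set: the perturbations have the same exponent, and distinct ones have distinct values because
  the digits of the value recover the sequence.
\<close>

lemma level_set_eqpoll_real:
  assumes f: "digit_seq f" and \<alpha>: "\<alpha> \<ge> 0"
    and conv: "\<And>s. s > \<alpha> \<Longrightarrow> summable (\<lambda>n. 1 / real (f n) powr s)"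
    and div: "\<And>s. 0 < s \<Longrightarrow> s < \<alpha> \<Longrightarrow> \<not> summable (\<lambda>n. 1 / real (f n) powr s)"
  shows "level_set \<alpha> \<approx> (UNIV :: real set)"
proof (rule lepoll_antisym)
  show "level_set \<alpha> \<lesssim> (UNIV :: real set)" by (simp add: subset_imp_lepoll)
  define g where "g B = pierce_value (perturb f B)" for B
  have digits: "pierce_digit (Suc n) (g B) = enat (perturb f B n)" for n B
    unfolding g_def by (rule pierce_digit_value[OF digit_seq_perturb[OF f]])
  have "inj g"
  proof (rule injI)
    fix B C assume "g B = g C"
    then have "perturb f B = perturb f C" using digits by (metis enat.inject ext)
    then show "B = C" using inj_perturb by (simp add: inj_eq)
  qed
  have range: "g B \<in> level_set \<alpha>" for B
  proof -
    have seq: "digit_seq (perturb f B)" by (rule digit_seq_perturb[OF f])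
    have "1 / real (perturb f B 0) \<le> 1"
      using digit_seq_pos[OF seq, of 0] by simp
    then have "g B \<in> {0..1}"
      using pierce_value_nonneg[OF seq] pierce_value_le[OF seq] by (simp add: g_def)
    moreover have "convergence_exponent (g B) = ereal \<alpha>"
      by (rule convergence_exponent_eqI)
         (use \<alpha> conv div in \<open>auto simp: digits recip_powr_def summable_perturb_iff[OF f]\<close>)
    ultimately show ?thesis by (simp add: level_set_def)
  qed
  have "inj (g \<circ> (\<lambda>x :: real. {n. of_rat (from_nat n) < x}))"
    using \<open>inj g\<close> inj_cut by (rule inj_compose)
  then show "(UNIV :: real set) \<lesssim> level_set \<alpha>"
    unfolding lepoll_def using range by (fastforce simp: comp_def)
qed

section \<open>Digit sequences with a given convergence exponent\<close>

text \<open>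
  Write \<open>x powr p = x * x powr (p - 1)\<close>: raising the first factor by 1 adds
  \<open>x powr (p - 1) \<ge> 1\<close>, and raising the base of the second does not decrease it.
\<close>

lemma powr_Suc_ge:
  assumes "p \<ge> 1"
  shows "real (Suc n) powr p + 1 \<le> real (Suc (Suc n)) powr p"
proof -
  have split: "real (Suc m) powr p = real (Suc m) * real (Suc m) powr (p - 1)" for m
    using powr_mult_base[of "real (Suc m)" "p - 1"] by simp
  have "real (Suc n) powr p + 1 \<le> real (Suc n) powr p + real (Suc n) powr (p - 1)"
    using assms by (simp add: ge_one_powr_ge_zero)
  also have "\<dots> = real (Suc (Suc n)) * real (Suc n) powr (p - 1)"
    unfolding split by (simp add: algebra_simps)
  also have "\<dots> \<le> real (Suc (Suc n)) * real (Suc (Suc n)) powr (p - 1)"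
    using assms by (intro mult_left_mono powr_mono2) auto
  finally show ?thesis by (simp only: split[of "Suc n"])
qed

definition power_digits :: "real \<Rightarrow> nat \<Rightarrow> nat" where
  "power_digits p n = nat \<lfloor>real (Suc n) powr p\<rfloor>"

lemma digit_seq_power_digits:
  assumes "p \<ge> 1"
  shows "digit_seq (power_digits p)"
  unfolding digit_seq_def
proof
  show "strict_mono (power_digits p)"
    unfolding strict_mono_Suc_iff
  proof
    fix n
    have "\<lfloor>real (Suc n) powr p + 1\<rfloor> \<le> \<lfloor>real (Suc (Suc n)) powr p\<rfloor>"
      by (rule floor_mono[OF powr_Suc_ge[OF assms]])
    moreover have "\<lfloor>real (Suc n) powr p\<rfloor> \<ge> 0" by simp
    ultimately show "power_digits p n < power_digits p (Suc n)"
      unfolding power_digits_def by linarith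
  qed
qed (simp add: power_digits_def)

text \<open>
  A real number that is at least 1 is at most twice its integer part, so the series is
  comparable to the sum of \<open>n powr (- (p * s))\<close>.
\<close>

lemma summable_power_digits_iff:
  assumes p: "p \<ge> 1" and s: "s > 0"
  shows "summable (\<lambda>n. 1 / real (power_digits p n) powr s) \<longleftrightarrow> p * s > 1"
proof -
  have "summable (\<lambda>n. 1 / real (power_digits p n) powr s)
      \<longleftrightarrow> summable (\<lambda>n. real (Suc n) powr (- (p * s)))"
  proof
    have one: "real (Suc n) powr p \<ge> 1" for n
      using p by (simp add: ge_one_powr_ge_zero)
    have upper: "real (power_digits p n) \<le> real (Suc n) powr p" for n
      using one[of n] by (simp add: power_digits_def)
    have lower: "real (Suc n) powr p \<le> 2 * real (power_digits p n)" for n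
    proof -
      have "1 \<le> \<lfloor>real (Suc n) powr p\<rfloor>" using one[of n] by simp
      then have "1 \<le> real (power_digits p n)" by (simp add: power_digits_def)
      moreover have "real (Suc n) powr p < real (power_digits p n) + 1"
        using one[of n] by (simp add: power_digits_def)
      ultimately show ?thesis by simp
    qed
    have pos: "real (power_digits p n) > 0" for n
      using digit_seq_pos[OF digit_seq_power_digits[OF p]] by simp
    have powr: "(real (Suc n) powr p) powr s = 1 / real (Suc n) powr (- (p * s))" for n
      by (simp add: powr_powr powr_minus divide_inverse)
    {
      assume "summable (\<lambda>n. 1 / real (power_digits p n) powr s)"
      then show "summable (\<lambda>n. real (Suc n) powr (- (p * s)))"
      proof (rule summable_comparison_test'[where N = 0])
        fix n
        have "real (power_digits p n) powr s \<le> 1 / real (Suc n) powr (- (p * s))"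
          using powr_mono2[OF _ _ upper[of n], of s] s unfolding powr by simp
        then show "norm (real (Suc n) powr (- (p * s))) \<le> 1 / real (power_digits p n) powr s"
          using pos[of n] by (simp add: field_simps)
      qed
    next
      assume "summable (\<lambda>n. real (Suc n) powr (- (p * s)))"
      then have "summable (\<lambda>n. 2 powr s * real (Suc n) powr (- (p * s)))"
        by (rule summable_mult)
      then show "summable (\<lambda>n. 1 / real (power_digits p n) powr s)"
      proof (rule summable_comparison_test'[where N = 0])
        fix n
        have "1 / real (Suc n) powr (- (p * s)) \<le> 2 powr s * real (power_digits p n) powr s"
          using powr_mono2[OF _ _ lower[of n], of s] s unfolding powr by (simp add: powr_mult)
        then show "norm (1 / real (power_digits p n) powr s)
            \<le> 2 powr s * real (Suc n) powr (- (p * s))"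
          using pos[of n] by (simp add: field_simps)
      qed
    }
  qed
  also have "\<dots> \<longleftrightarrow> summable (\<lambda>n. real n powr (- (p * s)))"
    by (rule summable_Suc_iff)
  also have "\<dots> \<longleftrightarrow> p * s > 1"
    by (simp add: summable_real_powr_iff)
  finally show ?thesis .
qed

lemma summable_recip_power_of_2_powr:
  assumes "s > 0"
  shows "summable (\<lambda>n. 1 / real (2 ^ n) powr s)"
proof -
  have "1 / real (2 ^ n) powr s = (1 / 2 powr s) ^ n" for n
    by (simp add: powr_realpow[symmetric] powr_powr power_one_over mult.commute)
  moreover have "summable (\<lambda>n. (1 / 2 powr s :: real) ^ n)"
    using assms by (intro summable_geometric) simp
  ultimately show ?thesis by simp
qed

theorem theorem1p10:
  fixes \<alpha> :: real
  assumes "\<alpha> \<in> {0..1}"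
  shows "level_set \<alpha> \<approx> (UNIV :: real set)"
proof (cases "\<alpha> = 0")
  case True
  have "digit_seq (\<lambda>n. 2 ^ n)" by (simp add: digit_seq_def strict_mono_def)
  then show ?thesis
    by (rule level_set_eqpoll_real) (use True summable_recip_power_of_2_powr in auto)
next
  case False
  then have \<alpha>: "\<alpha> > 0" "1 / \<alpha> \<ge> 1" using assms by auto
  show ?thesis
    by (rule level_set_eqpoll_real[OF digit_seq_power_digits[OF \<alpha>(2)]])
       (use \<alpha> in \<open>auto simp: summable_power_digits_iff\<close>)
qed

end
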